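(* For every integer $d \geq 2$ the following identities hold (so that the three values are best-possible upper bounds): $$B_{f_{\min}}^d = \frac{1}{d}, \qquad B_{f_{\max}}^d = \frac{d-1}{d}, \qquad B_{f_{\sum}}^d = \frac{d^2-1}{3},$$ where for a function $f\colon [0,1]^d \to \mathbb{R}$ $$B_f^d := \sup_{(x_n)_{n \in \mathbb{N}} \in \mathcal{U}} \ \limsup_{n \to \infty} \frac{1}{n} \sum_{i=1}^{n} f(x_i,x_{i+1},\ldots,x_{i+d-1}).$$
   Context: A sequence $(x_n)_{n\in\mathbb{N}}$ in $[0,1]$ is called uniformly distributed if for every interval $[a,b]\subseteq[0,1]$ one has $\lim_{n\to\infty}\frac1n\sum_{i=1}^n \mathbf{1}_{[a,b]}(x_i)=b-a$. $\mathcal{U}$ denotes the set of all uniformly distributed sequences in $[0,1]$. Write $[d]=\{1,\ldots,d\}$. The functions $f_{\min},f_{\max},f_{\sum}\colon[0,1]^d\to[0,\infty)$ are defined for $\mathbf{x}=(x_1,\ldots,x_d)$ by $f_{\min}(\mathbf{x})=\min_{i,j\in[d],\,i\neq j}|x_i-x_j|$, $f_{\max}(\mathbf{x})=\max_{i,j\in[d],\,i\neq j}|x_i-x_j|$, and $f_{\sum}(\mathbf{x})=\sum_{i,j\in[d]}|x_i-x_j|$ (sum over all ordered pairs $(i,j)\in[d]^2$). *)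

theory Defs
  imports
    Complex_Main
    "HOL-Library.FuncSet"
    "HOL-Library.Indicator_Function"
    "HOL-Library.Liminf_Limsup"
    "HOL-Library.Extended_Real"
begin

text \<open>
  Sequences are indexed by the positive integers: \<open>x :: nat \<Rightarrow> real\<close> stands for
  \<open>x 1, x 2, \<dots>\<close>, and the value \<open>x 0\<close> is never inspected.
\<close>

definition uniformly_distributed :: "(nat \<Rightarrow> real) \<Rightarrow> bool" where
  "uniformly_distributed x \<longleftrightarrow>
     (\<forall>a b. 0 \<le> a \<and> a \<le> b \<and> b \<le> 1 \<longrightarrow>
        (\<lambda>n. 1 / real n * (\<Sum>i = 1..n. indicator {a..b} (x i))) \<longlonglongrightarrow> b - a)"

definition ud_sequences :: "(nat \<Rightarrow> real) set" where
  "ud_sequences = {x. (\<forall>n\<ge>1. x n \<in> {0..1}) \<and> uniformly_distributed x}"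

text \<open>
  A point of \<open>[0,1]\<^sup>d\<close> is an element of \<open>{1..d} \<rightarrow>\<^sub>E {0..1}\<close>. The window of length \<open>d\<close> at
  \<open>i \<ge> 1\<close> is the point \<open>(x i, x (i+1), \<dots>, x (i+d-1))\<close>; restricting it to \<open>{1..d}\<close> ensures
  that a function applied to it sees only these \<open>d\<close> coordinates.
\<close>

definition window :: "nat \<Rightarrow> (nat \<Rightarrow> real) \<Rightarrow> nat \<Rightarrow> (nat \<Rightarrow> real)" where
  "window d x i = (\<lambda>k\<in>{1..d}. x (i + k - 1))"

text \<open>
  The extended reals are used because \<^const>\<open>limsup\<close> needs a complete lattice; no boundedness
  of \<open>f\<close> has to be presupposed.
\<close>

definition B :: "nat \<Rightarrow> ((nat \<Rightarrow> real) \<Rightarrow> real) \<Rightarrow> ereal" where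
  "B d f = (SUP x\<in>ud_sequences.
     limsup (\<lambda>n. ereal (1 / real n * (\<Sum>i = 1..n. f (window d x i)))))"

definition f_min :: "nat \<Rightarrow> (nat \<Rightarrow> real) \<Rightarrow> real" where
  "f_min d x = Min {\<bar>x i - x j\<bar> | i j. i \<in> {1..d} \<and> j \<in> {1..d} \<and> i \<noteq> j}"

definition f_max :: "nat \<Rightarrow> (nat \<Rightarrow> real) \<Rightarrow> real" where
  "f_max d x = Max {\<bar>x i - x j\<bar> | i j. i \<in> {1..d} \<and> j \<in> {1..d} \<and> i \<noteq> j}"

definition f_sum :: "nat \<Rightarrow> (nat \<Rightarrow> real) \<Rightarrow> real" where
  "f_sum d x = (\<Sum>i\<in>{1..d}. \<Sum>j\<in>{1..d}. \<bar>x i - x j\<bar>)"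

end

theory Submission
  imports Defs "HOL-Analysis.Analysis" "HOL-Real_Asymp.Real_Asymp"
begin

text \<open>
  Averaging a function of a single coordinate along a uniformly distributed sequence gives its
  integral. Hence if \<open>f w \<le> (\<Sum>k = 1..d. h (w k)) + c\<close> on the cube for a continuous \<open>h\<close>, then
  every window average of \<open>f\<close> is asymptotically at most \<open>d\<close> times the integral of \<open>h\<close>, plus \<open>c\<close>
  (\<open>B_le\<close>). The upper bounds come from choosing \<open>h\<close> so that this inequality is an equality whenever
  the sorted point has exactly one coordinate in each interval \<open>[(k-1)/d, k/d]\<close>.

  To find \<open>h\<close>, let \<open>y\<close> be the increasing rearrangement of \<open>w\<close> and let \<open>W k\<close> be the sum of its
  largest \<open>d - k\<close> entries minus the sum of the other \<open>k\<close>. Then \<open>f_sum\<close> is twice the sum of all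
  \<open>W k\<close> with \<open>1 \<le> k < d\<close>, and \<open>f_max\<close> is half of \<open>W 1 + W (d - 1)\<close>. For any threshold \<open>t\<close>, replacing
  \<open>\<plusminus> (y i - t)\<close> by \<open>\<bar>y i - t\<bar>\<close> bounds \<open>W k\<close> by a sum of one function over all coordinates, up to a
  constant (\<open>upper_minus_lower_le\<close>); the choice \<open>t = k / d\<close> is optimal. The bound for \<open>f_min\<close> follows
  from the one for \<open>f_max\<close>, because the range of \<open>d\<close> points is at least \<open>d - 1\<close> times their smallest
  gap.

  One sequence attains all three values: \<open>frac ((n + sqrt n) / d)\<close>. The term \<open>n / d\<close> makes each
  window nearly a set of \<open>d\<close> equally spaced points on the circle, while the unbounded but ever slower
  drift \<open>sqrt n / d\<close> spreads these points uniformly. So \<open>f_min\<close> of the windows is at least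
  \<open>1/d - 1/sqrt n\<close>, and the two estimates \<open>(d - 1) f_min \<le> f_max\<close> and
  \<open>d (d\<^sup>2 - 1) / 3 f_min \<le> f_sum\<close> turn this into the other two lower bounds.

  The uniform distribution of this sequence reduces to a statement about mean values, since
  \<open>\<lfloor>u - a\<rfloor> - \<lfloor>u - b\<rfloor>\<close> is the indicator of \<open>a \<le> frac u < b\<close> when \<open>0 \<le> a \<le> b \<le> 1\<close>: it is enough that for
  every \<open>c\<close> the mean of \<open>frac (u n + c)\<close> tends to \<open>1/2\<close>. Within a residue class modulo \<open>d\<close> the numbers
  \<open>u n\<close> grow in slowly shrinking steps modulo 1, and there the mean value is found by comparing the
  sum with increments of a periodic primitive of \<open>frac u - 1/2\<close> (\<open>slowly_growing_frac_sum\<close>).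
\<close>

section \<open>Mean fractional parts of slowly growing sequences\<close>

text \<open>
  The primitive of the sawtooth \<open>frac u - 1/2\<close> that vanishes at the integers. It is continuous and
  1-periodic, hence bounded.
\<close>

definition sawtooth_primitive :: "real \<Rightarrow> real" where
  "sawtooth_primitive u = frac u * (frac u - 1) / 2"

lemma sawtooth_primitive_bound: "\<bar>sawtooth_primitive u\<bar> \<le> 1 / 8"
proof -
  have "0 \<le> (2 * frac u - 1)\<^sup>2" by simp
  then have "- (1 / 4) \<le> frac u * (frac u - 1)" by (simp add: power2_eq_square algebra_simps)
  moreover have "frac u * (frac u - 1) \<le> 0"
    using frac_lt_1[of u] by (simp add: mult_nonneg_nonpos)
  ultimately show ?thesis by (simp add: sawtooth_primitive_def)
qed

text \<open>
  On an interval of length \<open>\<delta>\<close> containing no integer the sawtooth moves by at most \<open>\<delta>\<close>, so a first-order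
  expansion of the primitive has error at most \<open>\<delta>\<^sup>2 / 2\<close>. A jump of the sawtooth inside the interval
  costs at most a further \<open>\<delta>\<close>. The difference of floors counts these jumps, in a form that telescopes.
\<close>
lemma sawtooth_primitive_step:
  fixes v \<delta> :: real
  assumes "0 \<le> \<delta>" "\<delta> \<le> 1"
  shows "\<bar>\<delta> * (frac v - 1 / 2) - (sawtooth_primitive (v + \<delta>) - sawtooth_primitive v)\<bar>
           \<le> \<delta> * (\<delta> / 2 + (of_int \<lfloor>v + \<delta>\<rfloor> - of_int \<lfloor>v\<rfloor>))"
proof -
  define p where "p = frac v"
  have p: "0 \<le> p" "p < 1" "v = of_int \<lfloor>v\<rfloor> + p"
    by (simp_all add: p_def frac_lt_1) (simp add: frac_def)
  show ?thesis
  proof (cases "p + \<delta> < 1")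
    case True
    then have fl: "\<lfloor>v + \<delta>\<rfloor> = \<lfloor>v\<rfloor>" using p assms by linarith
    then have "frac (v + \<delta>) = p + \<delta>" by (simp add: frac_def p_def)
    then have "\<delta> * (frac v - 1 / 2) - (sawtooth_primitive (v + \<delta>) - sawtooth_primitive v) = - (\<delta> * \<delta> / 2)"
      by (simp add: sawtooth_primitive_def p_def[symmetric] field_simps)
    then show ?thesis using assms fl by (simp add: abs_mult)
  next
    case False
    then have fl: "\<lfloor>v + \<delta>\<rfloor> = \<lfloor>v\<rfloor> + 1" using p assms by linarith
    then have fr: "frac (v + \<delta>) = p + \<delta> - 1" by (simp add: frac_def p_def)
    have "\<delta> * (frac v - 1 / 2) - (sawtooth_primitive (v + \<delta>) - sawtooth_primitive v)
        = (p + \<delta> - 1) - \<delta> * \<delta> / 2"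
      unfolding sawtooth_primitive_def fr p_def[symmetric] by (simp add: field_simps)
    moreover have "0 \<le> p + \<delta> - 1" "p + \<delta> - 1 \<le> \<delta>" using False p by auto
    moreover have "0 \<le> \<delta> * \<delta>" by simp
    ultimately have "\<bar>\<delta> * (frac v - 1 / 2) - (sawtooth_primitive (v + \<delta>) - sawtooth_primitive v)\<bar> \<le> \<delta> + \<delta> * \<delta> / 2"
      using assms by linarith
    then show ?thesis using fl by (simp add: algebra_simps)
  qed
qed

text \<open>
  Every step of \<open>v\<close> has length \<open>1 / w m\<close>, so \<open>frac (v m) - 1/2\<close> is close to \<open>w m\<close> times an increment of the
  primitive. Summation by parts moves the differences onto \<open>w\<close>; as \<open>w\<close> is monotone and the primitive
  bounded by \<open>1/8\<close>, the result is controlled by the last \<open>w\<close>, and the expansion errors telescope to the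
  total growth of \<open>v\<close>. The bound is \<open>o(M)\<close> whenever \<open>v\<close> and \<open>w\<close> both grow sublinearly.
\<close>
lemma slowly_growing_frac_sum:
  fixes v w :: "nat \<Rightarrow> real"
  assumes step: "\<And>m. v (Suc m) = v m + 1 / w m"
    and w1: "\<And>m. 1 \<le> w m" and w_mono: "\<And>m. w m \<le> w (Suc m)"
  shows "\<bar>\<Sum>m<M. frac (v m) - 1 / 2\<bar> \<le> w M / 4 + 3 / 2 * (v M - v 0) + 1"
proof -
  let ?G = sawtooth_primitive
  have wpos: "0 < w m" for m using w1[of m] by linarith
  \<comment> \<open>Subtracting the boundary term of the summation by parts makes every error term telescope.\<close>
  have tele: "\<bar>(\<Sum>m<M. frac (v m) - 1 / 2) - w M * ?G (v M)\<bar>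
      \<le> (v M - v 0) / 2 + (of_int \<lfloor>v M\<rfloor> - of_int \<lfloor>v 0\<rfloor>) + w M / 8"
  proof (induction M)
    case 0
    show ?case using sawtooth_primitive_bound[of "v 0"] wpos[of 0] by (simp add: abs_mult)
  next
    case (Suc M)
    let ?k = "of_int \<lfloor>v (Suc M)\<rfloor> - of_int \<lfloor>v M\<rfloor> :: real"
    let ?\<delta> = "1 / w M"
    have "\<bar>?\<delta> * (frac (v M) - 1 / 2) - (?G (v (Suc M)) - ?G (v M))\<bar> \<le> ?\<delta> * (?\<delta> / 2 + ?k)"
      using sawtooth_primitive_step[of ?\<delta> "v M"] w1[of M] wpos[of M] by (simp add: step)
    then have "w M * \<bar>?\<delta> * (frac (v M) - 1 / 2) - (?G (v (Suc M)) - ?G (v M))\<bar> \<le> w M * (?\<delta> * (?\<delta> / 2 + ?k))"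
      using wpos[of M] by (intro mult_left_mono) auto
    moreover have "w M * \<bar>?\<delta> * (frac (v M) - 1 / 2) - (?G (v (Suc M)) - ?G (v M))\<bar>
        = \<bar>(frac (v M) - 1 / 2) - w M * (?G (v (Suc M)) - ?G (v M))\<bar>"
      using wpos[of M] by (subst abs_of_pos[OF wpos[of M], symmetric], subst abs_mult[symmetric])
        (simp add: algebra_simps)
    moreover have "w M * (?\<delta> * (?\<delta> / 2 + ?k)) = (v (Suc M) - v M) / 2 + ?k"
      using wpos[of M] by (simp add: step)
    ultimately have A: "\<bar>(frac (v M) - 1 / 2) - w M * (?G (v (Suc M)) - ?G (v M))\<bar>
        \<le> (v (Suc M) - v M) / 2 + ?k" by simp
    have B: "\<bar>(w (Suc M) - w M) * ?G (v (Suc M))\<bar> \<le> (w (Suc M) - w M) / 8"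
      using mult_left_mono[OF sawtooth_primitive_bound[of "v (Suc M)"], of "w (Suc M) - w M"] w_mono[of M]
      by (simp add: abs_mult)
    have "(\<Sum>m<Suc M. frac (v m) - 1 / 2) - w (Suc M) * ?G (v (Suc M))
       = ((\<Sum>m<M. frac (v m) - 1 / 2) - w M * ?G (v M))
         + ((frac (v M) - 1 / 2) - w M * (?G (v (Suc M)) - ?G (v M)))
         - (w (Suc M) - w M) * ?G (v (Suc M))"
      by (simp add: algebra_simps)
    then show ?case using Suc.IH A B unfolding add_divide_distrib diff_divide_distrib by linarith
  qed
  have "\<bar>w M * ?G (v M)\<bar> \<le> w M / 8"
    using mult_left_mono[OF sawtooth_primitive_bound[of "v M"], of "w M"] wpos[of M]
    by (simp add: abs_mult)
  moreover have "of_int \<lfloor>v M\<rfloor> - of_int \<lfloor>v 0\<rfloor> \<le> v M - v 0 + (1 :: real)" by linarith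
  ultimately show ?thesis using tele unfolding diff_divide_distrib right_diff_distrib by linarith
qed

text \<open>
  Cutting \<open>{..<N}\<close> into complete blocks of length \<open>d\<close> turns the sum into one sum per residue class; fewer
  than \<open>d\<close> bounded terms are left over.
\<close>
lemma cesaro_null_interleave:
  fixes a :: "nat \<Rightarrow> real"
  assumes d: "0 < d" and bnd: "\<And>n. \<bar>a n\<bar> \<le> C"
    and lim: "\<And>r. r < d \<Longrightarrow> (\<lambda>M. 1 / real M * (\<Sum>m<M. a (m * d + r))) \<longlonglongrightarrow> 0"
  shows "(\<lambda>N. 1 / real N * (\<Sum>n<N. a n)) \<longlonglongrightarrow> 0"
proof -
  let ?q = "\<lambda>N. N div d"
  have C: "0 \<le> C" using bnd[of 0] by linarith
  have filt: "filterlim ?q at_top at_top"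
    unfolding filterlim_at_top
  proof
    fix Z show "eventually (\<lambda>N. Z \<le> N div d) at_top"
      using eventually_ge_at_top[of "Z * d"]
      by eventually_elim (metis d div_le_mono nonzero_mult_div_cancel_right less_numeral_extra(3))
  qed
  have bound: "\<bar>1 / real N * (\<Sum>n<N. a n)\<bar>
      \<le> (\<Sum>r<d. \<bar>1 / real (?q N) * (\<Sum>m<?q N. a (m * d + r))\<bar>) + real d * C * (1 / real N)" for N
  proof (cases "N = 0")
    case False
    let ?M = "?q N"
    have N: "N = ?M * d + N mod d" by simp
    have "(\<Sum>n<N. a n) = (\<Sum>n<?M * d. a n) + (\<Sum>n=?M * d..<N. a n)"
      by (metis (no_types, lifting) N le_add1 sum.atLeastLessThan_concat lessThan_atLeast0 le0)
    moreover have "(\<Sum>n<?M * d. a n) = (\<Sum>r<d. \<Sum>m<?M. a (m * d + r))"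
    proof -
      have "(\<Sum>n<?M * d. a n) = (\<Sum>m<?M. \<Sum>r<d. a (m * d + r))"
        by (subst sum.nat_group[symmetric])
          (simp add: sum.shift_bounds_nat_ivl[of a 0 _ , simplified] atLeast0LessThan add.commute)
      then show ?thesis by (simp add: sum.swap[of _ "{..<d}"])
    qed
    moreover have "\<bar>\<Sum>n=?M * d..<N. a n\<bar> \<le> real d * C"
    proof -
      have "\<bar>\<Sum>n=?M * d..<N. a n\<bar> \<le> (\<Sum>n=?M * d..<N. C)"
        by (rule order_trans[OF sum_abs sum_mono]) (rule bnd)
      also have "\<dots> = real (N mod d) * C" 
        using N by (metis sum_constant card_atLeastLessThan add_diff_cancel_left')
      also have "\<dots> \<le> real d * C" using C d by (intro mult_right_mono) auto
      finally show ?thesis .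
    qed
    ultimately have 1: "\<bar>\<Sum>n<N. a n\<bar> \<le> (\<Sum>r<d. \<bar>\<Sum>m<?M. a (m * d + r)\<bar>) + real d * C"
      using sum_abs[of "\<lambda>r. \<Sum>m<?M. a (m * d + r)" "{..<d}"] by linarith
    have 2: "1 / real N * \<bar>\<Sum>m<?M. a (m * d + r)\<bar> \<le> \<bar>1 / real ?M * (\<Sum>m<?M. a (m * d + r))\<bar>" for r
    proof (cases "?M = 0")
      case M: False
      have "real ?M \<le> real N" by simp
      then have "1 / real N \<le> 1 / real ?M" using M False by (intro divide_left_mono) auto
      from mult_right_mono[OF this, of "\<bar>\<Sum>m<?M. a (m * d + r)\<bar>"] show ?thesis
        by (simp add: abs_mult)
    qed simp
    have "\<bar>1 / real N * (\<Sum>n<N. a n)\<bar> = 1 / real N * \<bar>\<Sum>n<N. a n\<bar>" by (simp add: abs_mult)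
    also have "\<dots> \<le> 1 / real N * ((\<Sum>r<d. \<bar>\<Sum>m<?M. a (m * d + r)\<bar>) + real d * C)"
      using 1 by (intro mult_left_mono) auto
    also have "\<dots> = (\<Sum>r<d. 1 / real N * \<bar>\<Sum>m<?M. a (m * d + r)\<bar>) + real d * C * (1 / real N)"
      by (simp add: sum_distrib_left distrib_left sum_divide_distrib add_divide_distrib)
    also have "\<dots> \<le> (\<Sum>r<d. \<bar>1 / real ?M * (\<Sum>m<?M. a (m * d + r))\<bar>) + real d * C * (1 / real N)"
      using 2 by (intro add_right_mono sum_mono) auto
    finally show ?thesis .
  qed (simp add: sum_nonneg)
  have "(\<lambda>N. \<bar>1 / real (?q N) * (\<Sum>m<?q N. a (m * d + r))\<bar>) \<longlonglongrightarrow> 0" if "r < d" for r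
    by (rule tendsto_rabs_zero) (rule filterlim_compose[OF lim[OF that] filt])
  then have "(\<lambda>N. \<Sum>r<d. \<bar>1 / real (?q N) * (\<Sum>m<?q N. a (m * d + r))\<bar>) \<longlonglongrightarrow> 0"
    by (intro tendsto_null_sum) simp
  from tendsto_add[OF this tendsto_mult[OF tendsto_const lim_1_over_n]]
  have "(\<lambda>N. (\<Sum>r<d. \<bar>1 / real (?q N) * (\<Sum>m<?q N. a (m * d + r))\<bar>) + real d * C * (1 / real N))
      \<longlonglongrightarrow> 0"
    by (simp only: mult_zero_right add_0_right)
  then show ?thesis
    by (rule Lim_null_comparison[OF always_eventually, rotated]) (unfold real_norm_def, rule allI, rule bound)
qed

text \<open>
  The floor difference \<open>\<lfloor>u - a\<rfloor> - \<lfloor>u - b\<rfloor>\<close> equals \<open>(b - a) + frac (u - b) - frac (u - a)\<close>, so under the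
  hypothesis its mean is \<open>b - a\<close>, for all real \<open>a\<close> and \<open>b\<close>. It is also the number of integers \<open>k\<close> with
  \<open>a \<le> u - k < b\<close>. This is a half-open condition, so the indicator of the closed interval is squeezed
  between the differences for \<open>b\<close> and for a slightly larger endpoint.
\<close>
lemma uniformly_distributed_if_frac_mean:
  fixes u :: "nat \<Rightarrow> real"
  assumes mean: "\<And>c. (\<lambda>N. 1 / real N * (\<Sum>n = 1..N. frac (u n + c) - 1 / 2)) \<longlonglongrightarrow> 0"
  shows "(\<lambda>n. frac (u n)) \<in> ud_sequences"
proof -
  have floors: "(\<lambda>N. 1 / real N * (\<Sum>n = 1..N. of_int (\<lfloor>u n - a\<rfloor> - \<lfloor>u n - b\<rfloor>))) \<longlonglongrightarrow> b - a"
    for a b :: real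
  proof -
    let ?m = "\<lambda>c N. 1 / real N * (\<Sum>n = 1..N. frac (u n + c) - 1 / 2)"
    have eq: "1 / real N * (\<Sum>n = 1..N. of_int (\<lfloor>u n - a\<rfloor> - \<lfloor>u n - b\<rfloor>)) = (b - a) + ?m (-b) N - ?m (-a) N"
      if "N > 0" for N
    proof -
      have "(\<Sum>n = 1..N. of_int (\<lfloor>u n - a\<rfloor> - \<lfloor>u n - b\<rfloor>))
        = (\<Sum>n = 1..N. (b - a) + (frac (u n + (-b)) - 1/2) - (frac (u n + (-a)) - 1/2))"
        by (intro sum.cong) (auto simp: frac_def)
      also have "\<dots> = real N * (b - a) + (\<Sum>n = 1..N. frac (u n + (-b)) - 1/2)
           - (\<Sum>n = 1..N. frac (u n + (-a)) - 1/2)"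
        by (simp only: sum_subtractf sum.distrib) (simp add: right_diff_distrib)
      finally have "1 / real N * (\<Sum>n = 1..N. of_int (\<lfloor>u n - a\<rfloor> - \<lfloor>u n - b\<rfloor>))
           = 1 / real N * (real N * (b - a)) + ?m (-b) N - ?m (-a) N"
        by (simp only: distrib_left right_diff_distrib)
      then show ?thesis using that by simp
    qed
    have "eventually (\<lambda>N. (b - a) + ?m (-b) N - ?m (-a) N
        = 1 / real N * (\<Sum>n = 1..N. of_int (\<lfloor>u n - a\<rfloor> - \<lfloor>u n - b\<rfloor>))) sequentially"
      using eventually_gt_at_top[of 0] by eventually_elim (rule eq[symmetric])
    moreover have "(\<lambda>N. (b - a) + ?m (-b) N - ?m (-a) N) \<longlonglongrightarrow> (b - a) + 0 - 0"
      by (intro tendsto_intros mean)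
    ultimately have "(\<lambda>N. 1 / real N * (\<Sum>n = 1..N. of_int (\<lfloor>u n - a\<rfloor> - \<lfloor>u n - b\<rfloor>))) \<longlonglongrightarrow> (b - a) + 0 - 0"
      by (rule Lim_transform_eventually[rotated])
    then show ?thesis by simp
  qed
  have "(\<lambda>N. 1 / real N * (\<Sum>n = 1..N. indicator {a..b} (frac (u n)))) \<longlonglongrightarrow> b - a"
    if ab: "0 \<le> a" "a \<le> b" "b \<le> 1" for a b :: real
  proof (rule tendstoI)
    fix e :: real assume e: "0 < e"
    let ?F = "\<lambda>b' N. 1 / real N * (\<Sum>n = 1..N. real_of_int (\<lfloor>u n - a\<rfloor> - \<lfloor>u n - b'\<rfloor>))"
    let ?I = "\<lambda>N. 1 / real N * (\<Sum>n = 1..N. indicator {a..b} (frac (u n)))"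
    have lo: "real_of_int (\<lfloor>y - a\<rfloor> - \<lfloor>y - b\<rfloor>) \<le> indicator {a..b} (frac y)" for y
    proof -
      have p: "y = of_int \<lfloor>y\<rfloor> + frac y" "0 \<le> frac y" "frac y < 1" by (auto simp: frac_def frac_lt_1) linarith
      show ?thesis
      proof (cases "frac y \<in> {a..b}")
        case True
        have "\<lfloor>y - a\<rfloor> - \<lfloor>y - b\<rfloor> \<le> 1" using p ab True by (simp) linarith
        then show ?thesis using True by simp
      next
        case False
        then consider "frac y < a" | "b < frac y" by fastforce
        then have "\<lfloor>y - a\<rfloor> \<le> \<lfloor>y - b\<rfloor>"
        proof cases
          case 1
          have "\<lfloor>y - a\<rfloor> < \<lfloor>y\<rfloor>" "\<lfloor>y\<rfloor> - 1 \<le> \<lfloor>y - b\<rfloor>" using p ab 1 by linarith+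
          then show ?thesis by linarith
        next
          case 2
          have "\<lfloor>y - a\<rfloor> \<le> \<lfloor>y\<rfloor>" "\<lfloor>y\<rfloor> \<le> \<lfloor>y - b\<rfloor>" using p ab 2 by linarith+
          then show ?thesis by linarith
        qed
        then show ?thesis using False by simp
      qed
    qed
    have hi: "indicator {a..b} (frac y) \<le> real_of_int (\<lfloor>y - a\<rfloor> - \<lfloor>y - (b + e / 2)\<rfloor>)" for y
    proof (cases "frac y \<in> {a..b}")
      case True
      have p: "y = of_int \<lfloor>y\<rfloor> + frac y" by (simp add: frac_def)
      have "\<lfloor>y\<rfloor> \<le> \<lfloor>y - a\<rfloor>" using p True by (simp) linarith
      moreover have "\<lfloor>y - (b + e / 2)\<rfloor> < \<lfloor>y\<rfloor>" using p True e by (simp) linarith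
      ultimately show ?thesis using True by simp
    next
      case False
      have "\<lfloor>y - (b + e / 2)\<rfloor> \<le> \<lfloor>y - a\<rfloor>" using ab e by (intro floor_mono) auto
      then show ?thesis using False by simp
    qed
    have "eventually (\<lambda>N. b - a - e < ?F b N) sequentially"
      using order_tendstoD(1)[OF floors[of a b]] e by simp
    moreover have "eventually (\<lambda>N. ?F (b + e / 2) N < b - a + e) sequentially"
      using order_tendstoD(2)[OF floors[where a=a and b="b + e / 2"]] e by simp
    ultimately show "eventually (\<lambda>N. dist (?I N) (b - a) < e) sequentially"
    proof eventually_elim
      case (elim N)
      have "?F b N \<le> ?I N" by (intro mult_left_mono sum_mono lo) auto
      moreover have "?I N \<le> ?F (b + e / 2) N" by (intro mult_left_mono sum_mono hi) auto
      ultimately show ?case using elim by (auto simp: dist_real_def abs_less_iff)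
    qed
  qed
  then show ?thesis
    by (auto simp: ud_sequences_def uniformly_distributed_def less_imp_le[OF frac_lt_1])
qed

text \<open>
  In the residue class \<open>n = m d + s\<close> the term \<open>m\<close> of \<open>(n + sqrt n) / d\<close> is an integer and drops out, leaving
  \<open>sqrt (m d + s) / d\<close> plus a constant. Dividing the root by \<open>d\<close> makes the reciprocal of a step the sum of
  two consecutive roots, which is at least 1.
\<close>
lemma drifting_residues_uniformly_distributed:
  assumes d: "0 < d"
  shows "(\<lambda>n. frac ((real n + sqrt (real n)) / real d)) \<in> ud_sequences"
proof (rule uniformly_distributed_if_frac_mean)
  fix c :: real
  \<comment> \<open>Averages start at index 1, so the summand is shifted to start at 0.\<close>
  let ?a = "\<lambda>n. frac ((real (Suc n) + sqrt (real (Suc n))) / real d + c) - 1 / 2"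
  have "(\<lambda>N. 1 / real N * (\<Sum>n<N. ?a n)) \<longlonglongrightarrow> 0"
  proof (rule cesaro_null_interleave[OF d])
    show "\<bar>?a n\<bar> \<le> 1" for n
      using frac_ge_0[of "(real (Suc n) + sqrt (real (Suc n))) / real d + c"]
        frac_lt_1[of "(real (Suc n) + sqrt (real (Suc n))) / real d + c"]
      by linarith
  next
    fix r :: nat
    define s where "s = real (Suc r)"
    have s: "s \<ge> 1" by (simp add: s_def)
    define v where "v = (\<lambda>m::nat. sqrt (real d * real m + s) / real d + (s / real d + c))"
    define w where "w = (\<lambda>m::nat. sqrt (real d * (real m + 1) + s) + sqrt (real d * real m + s))"
    have a_v: "?a (m * d + r) = frac (v m) - 1 / 2" for m
    proof -
      have "(real (Suc (m * d + r)) + sqrt (real (Suc (m * d + r)))) / real d + c = v m + of_int (int m)"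
        using d by (simp add: v_def s_def field_simps)
      then show ?thesis by (simp only: frac_add_of_int_right)
    qed
    have sq1: "1 \<le> sqrt (real d * real m + s)" for m
      using s by (simp add: add_increasing)
    have step: "v (Suc m) = v m + 1 / w m" for m
    proof -
      let ?x = "sqrt (real d * (real m + 1) + s)" and ?y = "sqrt (real d * real m + s)"
      have pos: "0 < ?x + ?y" using sq1[of m] s by (intro add_nonneg_pos) auto
      have "(?x + ?y) * (?x - ?y) = ?x\<^sup>2 - ?y\<^sup>2" by (simp add: power2_eq_square algebra_simps)
      also have "\<dots> = real d" using s by (simp add: algebra_simps)
      finally have "(?x - ?y) / real d = 1 / (?x + ?y)"
        using pos d by (simp add: field_simps)
      moreover have "v (Suc m) - v m = (?x - ?y) / real d"
        by (simp add: v_def diff_divide_distrib add.commute)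
      ultimately show ?thesis by (simp add: w_def)
    qed
    have w1: "1 \<le> w m" for m
      using sq1[of m] s unfolding w_def by (intro add_increasing) auto
    have w_mono: "w m \<le> w (Suc m)" for m
      unfolding w_def using s by (intro add_mono real_sqrt_le_mono) (auto simp: algebra_simps)
    have bound: "\<bar>1 / real M * (\<Sum>m<M. ?a (m * d + r))\<bar>
        \<le> (w M / 4 + 3 / 2 * (v M - v 0) + 1) / real M" for M
      using divide_right_mono[OF slowly_growing_frac_sum[of v w, OF step w1 w_mono, of M], of "real M"]
      unfolding a_v by (simp add: abs_mult)
    have "(\<lambda>M. ((sqrt (D * (real M + 1) + t) + sqrt (D * real M + t)) / 4
        + 3 / 2 * (sqrt (D * real M + t) / D + e - K) + 1) / real M) \<longlonglongrightarrow> 0"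
      if "0 < D" "1 \<le> t" for D t e K :: real
      using that by real_asymp
    from this[of "real d" s "s / real d + c" "v 0"]
    have "(\<lambda>M. (w M / 4 + 3 / 2 * (v M - v 0) + 1) / real M) \<longlonglongrightarrow> 0"
      using d s by (simp only: w_def v_def of_nat_0_less_iff)
    then show "(\<lambda>M. 1 / real M * (\<Sum>m<M. ?a (m * d + r))) \<longlonglongrightarrow> 0"
      by (rule Lim_null_comparison[OF always_eventually, rotated]) (unfold real_norm_def, rule allI, rule bound)
  qed
  moreover have "(\<Sum>n = 1..N. frac ((real n + sqrt (real n)) / real d + c) - 1 / 2) = (\<Sum>n<N. ?a n)" for N
    by (rule sum.reindex_bij_witness[of _ Suc "\<lambda>n. n - 1"]) auto
  ultimately show "(\<lambda>N. 1 / real N * (\<Sum>n = 1..N. frac ((real n + sqrt (real n)) / real d + c) - 1 / 2)) \<longlonglongrightarrow> 0"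
    by simp
qed

section \<open>Averages along uniformly distributed sequences\<close>

text \<open>
  The function is bounded above by a step function on \<open>K\<close> closed cells of equal length. Neighbouring cells
  overlap in an endpoint; since the function is nonnegative, counting such a point twice only increases
  the upper bound, so half-open intervals can be avoided.
\<close>
lemma ud_average_eventually_le:
  fixes f :: "real \<Rightarrow> real"
  assumes x: "x \<in> ud_sequences" and cont: "continuous_on {0..1} f"
    and nonneg: "\<And>s. s \<in> {0..1} \<Longrightarrow> 0 \<le> f s" and e: "0 < e"
  shows "eventually (\<lambda>N. 1 / real N * (\<Sum>n = 1..N. f (x n)) \<le> integral {0..1} f + e) sequentially"
proof -
  obtain \<delta> where \<delta>: "0 < \<delta>"
    and uc: "\<And>s s'. s \<in> {0..1} \<Longrightarrow> s' \<in> {0..1} \<Longrightarrow> dist s' s < \<delta> \<Longrightarrow> dist (f s') (f s) < e / 3"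
    using compact_uniformly_continuous[OF cont] e
    unfolding uniformly_continuous_on_def by (metis compact_Icc zero_less_divide_iff zero_less_numeral)
  obtain K0 :: nat where K0: "1 / \<delta> < real K0" using reals_Archimedean2 by blast
  define K where "K = Suc K0"
  have K: "0 < K" "1 / real K < \<delta>"
  proof -
    show "0 < K" by (simp add: K_def)
    have "1 / \<delta> < real K" using K0 by (simp add: K_def)
    then show "1 / real K < \<delta>" using \<delta> \<open>0 < K\<close> by (simp add: field_simps)
  qed
  define p where "p = (\<lambda>j. real j / real K)"
  have p_step: "p (Suc j) = p j + 1 / real K" for j by (simp add: p_def add_divide_distrib)
  have p_mono: "p i \<le> p j" if "i \<le> j" for i j using that by (simp add: p_def divide_right_mono)
  have p_0: "p 0 = 0" and p_K: "p K = 1" using K by (simp_all add: p_def)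
  have p01: "0 \<le> p j" "p j \<le> 1" if "j \<le> K" for j
    using p_mono[of 0 j] p_mono[of j K] that p_0 p_K by auto
  define cell where "cell = (\<lambda>j. {p j..p (Suc j)})"
  have cell_sub: "cell j \<subseteq> {0..1}" if "j < K" for j
    using that p01[of j] p01[of "Suc j"] by (auto simp: cell_def)
  have cell_near: "\<bar>f s - f (p j)\<bar> < e / 3" if "j < K" "s \<in> cell j" for s j
  proof -
    have "dist s (p j) < \<delta>" using that(2) K p_step[of j] by (auto simp: cell_def dist_real_def)
    then show ?thesis
      using uc[of "p j" s] that cell_sub[of j] p01[of j] by (auto simp: dist_real_def)
  qed
  have cell_lower: "f (p j) - e / 3 \<le> f s" if "j < K" "s \<in> cell j" for s j
    using cell_near[OF that] by linarith
  have cover: "\<exists>j<K. s \<in> cell j" if s: "s \<in> {0..1}" for s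
  proof (cases "s = 1")
    case True
    then have "s \<in> cell (K - 1)" using K p_mono[of "K - 1" K] by (simp add: cell_def p_K)
    then show ?thesis using K by (intro exI[of _ "K - 1"]) auto
  next
    case False
    define j where "j = nat \<lfloor>s * real K\<rfloor>"
    have "real j \<le> s * real K" "s * real K < real j + 1"
      using s K by (auto simp: j_def of_nat_nat)
    moreover have "s * real K < real K" using False s K by auto
    ultimately have "j < K" "s \<in> cell j"
      using K by (linarith, auto simp: cell_def p_def field_simps)
    then show ?thesis by blast
  qed
  let ?M = "\<lambda>j. f (p j) + e / 3"
  have M_nonneg: "0 \<le> ?M j" if "j < K" for j using nonneg[of "p j"] p01[of j] that e by simp
  have f_le: "f s \<le> (\<Sum>j<K. ?M j * indicator (cell j) s)" if s: "s \<in> {0..1}" for s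
  proof -
    obtain j where j: "j < K" "s \<in> cell j" using cover[OF s] by blast
    have "f s \<le> ?M j * indicator (cell j) s" using cell_near[OF j] j(2) by (simp only: indicator_simps mult_1_right)
    also have "\<dots> \<le> (\<Sum>j<K. ?M j * indicator (cell j) s)"
      using j M_nonneg by (intro member_le_sum mult_nonneg_nonneg) auto
    finally show ?thesis .
  qed
  have int_f: "f integrable_on {a..b}" if "0 \<le> a" "b \<le> 1" for a b
    using cont that by (intro integrable_continuous_real continuous_on_subset[OF cont]) auto
  have integral_cells: "(\<Sum>j<m. integral (cell j) f) = integral {0..p m} f" if "m \<le> K" for m
    using that
  proof (induction m)
    case 0
    then show ?case by (simp add: p_0)
  next
    case (Suc m)
    have "integral {0..p m} f + integral {p m..p (Suc m)} f = integral {0..p (Suc m)} f"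
      using Suc.prems p01[of m] p01[of "Suc m"] p_mono[of m "Suc m"]
      by (intro Henstock_Kurzweil_Integration.integral_combine int_f) auto
    then show ?case using Suc by (simp add: cell_def)
  qed
  have cell_int: "?M j * (1 / real K) \<le> integral (cell j) f + 2 * e / 3 * (1 / real K)" if "j < K" for j
  proof -
    have "integral (cell j) (\<lambda>s. f (p j) - e / 3) \<le> integral (cell j) f"
      using that p01[of j] p01[of "Suc j"] cell_lower[OF that]
      unfolding cell_def by (intro integral_le int_f) auto
    moreover have "integral (cell j) (\<lambda>s. f (p j) - e / 3) = (f (p j) - e / 3) * (1 / real K)"
      using K p_mono[of j "Suc j"] unfolding cell_def by (simp add: p_step)
    ultimately show ?thesis by (simp add: algebra_simps)
  qed
  have "(\<Sum>j<K. ?M j * (1 / real K)) \<le> (\<Sum>j<K. integral (cell j) f + 2 * e / 3 * (1 / real K))"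
    by (intro sum_mono cell_int) auto
  also have "\<dots> = integral {0..1} f + 2 * e / 3"
    using K integral_cells[of K] by (simp add: sum.distrib p_K)
  also have "\<dots> < integral {0..1} f + e" using e by simp
  finally have riemann: "(\<Sum>j<K. ?M j * (1 / real K)) < integral {0..1} f + e" .
  have freq: "(\<lambda>N. 1 / real N * (\<Sum>n = 1..N. indicator (cell j) (x n))) \<longlonglongrightarrow> 1 / real K" if "j < K" for j
  proof -
    have "(\<lambda>N. 1 / real N * (\<Sum>n = 1..N. indicator {p j..p (Suc j)} (x n))) \<longlonglongrightarrow> p (Suc j) - p j"
      using x that p01[of j] p01[of "Suc j"] p_mono[of j "Suc j"]
      by (auto simp: ud_sequences_def uniformly_distributed_def)
    then show ?thesis by (simp add: cell_def p_step)
  qed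
  have "(\<lambda>N. \<Sum>j<K. ?M j * (1 / real N * (\<Sum>n = 1..N. indicator (cell j) (x n)))) \<longlonglongrightarrow> (\<Sum>j<K. ?M j * (1 / real K))"
    by (intro tendsto_sum tendsto_mult tendsto_const freq) auto
  from order_tendstoD(2)[OF this riemann] show ?thesis
  proof eventually_elim
    case (elim N)
    have "1 / real N * (\<Sum>n = 1..N. f (x n)) \<le> 1 / real N * (\<Sum>n = 1..N. \<Sum>j<K. ?M j * indicator (cell j) (x n))"
      using x by (intro mult_left_mono sum_mono f_le) (auto simp: ud_sequences_def)
    also have "\<dots> = (\<Sum>j<K. ?M j * (1 / real N * (\<Sum>n = 1..N. indicator (cell j) (x n))))"
      unfolding sum_distrib_left by (subst sum.swap) (simp only: mult_ac)
    finally show ?case using elim by linarith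
  qed
qed

text \<open>
  Only the upper bound for nonnegative functions is at hand; applied to \<open>C + f\<close> and \<open>C - f\<close>, where \<open>C\<close>
  bounds \<open>\<bar>f\<bar>\<close>, it gives both halves of the limit.
\<close>
lemma ud_average_tendsto_integral:
  fixes f :: "real \<Rightarrow> real"
  assumes x: "x \<in> ud_sequences" and cont: "continuous_on {0..1} f"
  shows "(\<lambda>N. 1 / real N * (\<Sum>n = 1..N. f (x n))) \<longlonglongrightarrow> integral {0..1} f"
proof (rule tendstoI)
  fix e :: real assume e: "0 < e"
  obtain C where "\<forall>y \<in> f ` {0..1}. norm y \<le> C"
    using compact_imp_bounded[OF compact_continuous_image[OF cont compact_Icc]]
    unfolding bounded_iff by blast
  then have C: "\<bar>f s\<bar> \<le> C" if "s \<in> {0..1}" for s using that by auto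
  have int: "f integrable_on {0..1}" using cont by (rule integrable_continuous_real)
  have 1: "eventually (\<lambda>N. 1 / real N * (\<Sum>n = 1..N. C + f (x n)) \<le> integral {0..1} (\<lambda>s. C + f s) + e / 2) sequentially"
    using e C by (intro ud_average_eventually_le x continuous_intros cont) (force simp: abs_le_iff)+
  have 2: "eventually (\<lambda>N. 1 / real N * (\<Sum>n = 1..N. C - f (x n)) \<le> integral {0..1} (\<lambda>s. C - f s) + e / 2) sequentially"
    using e C by (intro ud_average_eventually_le x continuous_intros cont) (force simp: abs_le_iff)+
  have i: "integral {0..1} (\<lambda>s. C + f s) = C + integral {0..1} f"
    "integral {0..1} (\<lambda>s. C - f s) = C - integral {0..1} f"
    using has_integral_add[OF has_integral_const_real[of C 0 1] integrable_integral[OF int]]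
      has_integral_diff[OF has_integral_const_real[of C 0 1] integrable_integral[OF int]]
    by (auto dest: integral_unique)
  from 1 2 eventually_gt_at_top[of 0]
  show "eventually (\<lambda>N. dist (1 / real N * (\<Sum>n = 1..N. f (x n))) (integral {0..1} f) < e) sequentially"
  proof eventually_elim
    case (elim N)
    have "1 / real N * (\<Sum>n = 1..N. C + f (x n)) = C + 1 / real N * (\<Sum>n = 1..N. f (x n))"
      "1 / real N * (\<Sum>n = 1..N. C - f (x n)) = C - 1 / real N * (\<Sum>n = 1..N. f (x n))"
      using elim(3) by (simp_all add: sum.distrib sum_subtractf add_divide_distrib diff_divide_distrib)
    with elim e show ?case unfolding i dist_real_def abs_less_iff by linarith
  qed
qed

lemma ud_shift:
  assumes x: "x \<in> ud_sequences"
  shows "(\<lambda>n. x (n + j)) \<in> ud_sequences"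
proof -
  have "(\<lambda>N. 1 / real N * (\<Sum>n = 1..N. indicator {a..b} (x (n + j)))) \<longlonglongrightarrow> b - a"
    if ab: "0 \<le> a" "a \<le> b" "b \<le> 1" for a b :: real
  proof -
    define S where "S = (\<lambda>N. \<Sum>n = 1..N. indicator {a..b} (x n) :: real)"
    have "(\<lambda>N. 1 / real N * S N) \<longlonglongrightarrow> b - a"
      using x ab by (auto simp: S_def ud_sequences_def uniformly_distributed_def)
    then have "(\<lambda>N. 1 / real (N + j) * S (N + j)) \<longlonglongrightarrow> b - a"
      by (rule LIMSEQ_ignore_initial_segment)
    moreover have "(\<lambda>N. real j * (1 / real N)) \<longlonglongrightarrow> real j * 0" "(\<lambda>N. S j * (1 / real N)) \<longlonglongrightarrow> S j * 0"
      by (intro tendsto_mult tendsto_const lim_1_over_n)+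
    \<comment> \<open>The factor \<open>1 + j / N\<close> rescales the average over \<open>N + j\<close> terms to one over \<open>N\<close> terms.\<close>
    ultimately have "(\<lambda>N. (1 + real j * (1 / real N)) * (1 / real (N + j) * S (N + j)) - S j * (1 / real N))
        \<longlonglongrightarrow> (1 + real j * 0) * (b - a) - S j * 0"
      by (intro tendsto_intros)
    moreover have "eventually (\<lambda>N. (1 + real j * (1 / real N)) * (1 / real (N + j) * S (N + j)) - S j * (1 / real N)
        = 1 / real N * (\<Sum>n = 1..N. indicator {a..b} (x (n + j)))) sequentially"
      using eventually_gt_at_top[of 0]
    proof eventually_elim
      case (elim N)
      have "S (N + j) = S j + (\<Sum>n = 1..N. indicator {a..b} (x (n + j)))"
      proof (induction N)
        case (Suc N) then show ?case by (simp add: S_def add.commute)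
      qed (simp add: S_def)
      moreover have "(1 + real j * (1 / real N)) * (1 / real (N + j) * S (N + j)) = S (N + j) / real N"
      proof -
        have "1 + real j * (1 / real N) = real (N + j) / real N" using elim by (simp add: field_simps)
        then show ?thesis using elim by simp
      qed
      ultimately show ?case by (simp add: add_divide_distrib)
    qed
    ultimately have "(\<lambda>N. 1 / real N * (\<Sum>n = 1..N. indicator {a..b} (x (n + j))))
        \<longlonglongrightarrow> (1 + real j * 0) * (b - a) - S j * 0"
      by (rule Lim_transform_eventually)
    then show ?thesis by simp
  qed
  then show ?thesis using x by (auto simp: ud_sequences_def uniformly_distributed_def)
qed

text \<open>
  Each coordinate of the window runs through a shift of the sequence, which is again uniformly
  distributed; so all \<open>d\<close> coordinates contribute the same integral.
\<close>
lemma B_le: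
  assumes cont: "continuous_on {0..1} h"
    and le: "\<And>w. w \<in> {1..d} \<rightarrow>\<^sub>E {0..1} \<Longrightarrow> f w \<le> (\<Sum>k = 1..d. h (w k)) + c"
  shows "B d f \<le> ereal (real d * integral {0..1} h + c)"
  unfolding B_def
proof (rule SUP_least)
  fix x assume x: "x \<in> ud_sequences"
  let ?A = "\<lambda>k N. 1 / real N * (\<Sum>n = 1..N. h (x (n + (k - 1))))"
  have "(\<lambda>N. (\<Sum>k = 1..d. ?A k N) + c) \<longlonglongrightarrow> (\<Sum>k = 1..d. integral {0..1} h) + c"
    by (intro tendsto_intros ud_average_tendsto_integral ud_shift x cont)
  then have lim: "limsup (\<lambda>N. ereal ((\<Sum>k = 1..d. ?A k N) + c)) = ereal (real d * integral {0..1} h + c)"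
    by (intro lim_imp_Limsup) simp_all
  have "eventually (\<lambda>N. ereal (1 / real N * (\<Sum>n = 1..N. f (window d x n)))
      \<le> ereal ((\<Sum>k = 1..d. ?A k N) + c)) sequentially"
    using eventually_gt_at_top[of 0]
  proof eventually_elim
    case (elim N)
    have "f (window d x n) \<le> (\<Sum>k = 1..d. h (x (n + (k - 1)))) + c" if "n \<ge> 1" for n
    proof -
      have "window d x n \<in> {1..d} \<rightarrow>\<^sub>E {0..1}"
        using x that by (auto simp: window_def ud_sequences_def)
      from le[OF this] show ?thesis by (simp add: window_def)
    qed
    then have "1 / real N * (\<Sum>n = 1..N. f (window d x n))
        \<le> 1 / real N * (\<Sum>n = 1..N. (\<Sum>k = 1..d. h (x (n + (k - 1)))) + c)"
      by (intro mult_left_mono sum_mono) auto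
    also have "\<dots> = 1 / real N * (\<Sum>n = 1..N. \<Sum>k = 1..d. h (x (n + (k - 1)))) + c"
      using elim by (simp add: sum.distrib add_divide_distrib)
    also have "\<dots> = (\<Sum>k = 1..d. ?A k N) + c"
      by (subst sum.swap) (simp add: sum_distrib_left)
    finally show ?case by simp
  qed
  then show "limsup (\<lambda>N. ereal (1 / real N * (\<Sum>n = 1..N. f (window d x n)))) \<le> ereal (real d * integral {0..1} h + c)"
    unfolding lim[symmetric] by (rule Limsup_mono)
qed

lemma integral_abs_diff:
  fixes t :: real
  assumes "0 \<le> t" "t \<le> 1"
  shows "((\<lambda>s. \<bar>s - t\<bar>) has_integral (t\<^sup>2 + (1 - t)\<^sup>2) / 2) {0..1}"
proof -
  have "((\<lambda>s. t - s) has_integral (- ((t - t)\<^sup>2 / 2)) - (- ((t - 0)\<^sup>2 / 2))) {0..t}"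
    using assms by (intro fundamental_theorem_of_calculus)
      (auto intro!: derivative_eq_intros simp: has_real_derivative_iff_has_vector_derivative[symmetric] field_simps)
  then have "((\<lambda>s. \<bar>s - t\<bar>) has_integral t\<^sup>2 / 2) {0..t}"
    by (subst has_integral_cong[where g = "\<lambda>s. t - s"]) auto
  moreover have "((\<lambda>s. s - t) has_integral ((1 - t)\<^sup>2 / 2) - ((t - t)\<^sup>2 / 2)) {t..1}"
    using assms by (intro fundamental_theorem_of_calculus)
      (auto intro!: derivative_eq_intros simp: has_real_derivative_iff_has_vector_derivative[symmetric] field_simps)
  then have "((\<lambda>s. \<bar>s - t\<bar>) has_integral (1 - t)\<^sup>2 / 2) {t..1}"
    by (subst has_integral_cong[where g = "\<lambda>s. s - t"]) auto
  ultimately show ?thesis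
    using has_integral_combine[OF assms] by (auto simp: add_divide_distrib)
qed

section \<open>Sorted points\<close>

lemma exists_increasing_rearrangement:
  fixes x :: "nat \<Rightarrow> real"
  obtains p where "bij_betw p {1..d} {1..d}"
    and "\<And>i j. 1 \<le> i \<Longrightarrow> i \<le> j \<Longrightarrow> j \<le> d \<Longrightarrow> x (p i) \<le> x (p j)"
proof
  define xs where "xs = sort_key x [1..<Suc d]"
  have len: "length xs = d" and dist: "distinct xs" and set: "set xs = {1..d}"
    by (auto simp: xs_def)
  have sorted: "sorted (map x xs)" by (simp add: xs_def)
  have "bij_betw (\<lambda>i. i - 1) {1..d} {..<d}"
    by (rule bij_betwI[where g = Suc]) auto
  moreover have "bij_betw ((!) xs) {..<d} {1..d}"
    using dist len set by (intro bij_betw_nth) auto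
  ultimately show "bij_betw (\<lambda>i. xs ! (i - 1)) {1..d} {1..d}"
    using bij_betw_trans by (fastforce simp: comp_def)
  show "x (xs ! (i - 1)) \<le> x (xs ! (j - 1))" if "1 \<le> i" "i \<le> j" "j \<le> d" for i j
    using sorted_nth_mono[OF sorted, of "i - 1" "j - 1"] that len by simp
qed

lemma pair_distances_eq_image:
  "{\<bar>x i - x j\<bar> | i j. i \<in> {1..d} \<and> j \<in> {1..d} \<and> i \<noteq> j}
     = (\<lambda>(i, j). \<bar>x i - x j\<bar>) ` {(i, j) \<in> {1..d} \<times> {1..d}. i \<noteq> j}"
  for x :: "nat \<Rightarrow> real"
  by auto

lemma finite_pair_distances: "finite {\<bar>x i - x j\<bar> | i j. i \<in> {1..d} \<and> j \<in> {1..d} \<and> i \<noteq> j}"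
  for x :: "nat \<Rightarrow> real"
  unfolding pair_distances_eq_image by (rule finite_imageI, rule finite_subset[of _ "{1..d} \<times> {1..d}"]) auto

lemma pair_distances_nonempty:
  fixes x :: "nat \<Rightarrow> real"
  assumes "2 \<le> d"
  shows "{\<bar>x i - x j\<bar> | i j. i \<in> {1..d} \<and> j \<in> {1..d} \<and> i \<noteq> j} \<noteq> {}"
proof -
  have "(1, 2) \<in> {(i, j) \<in> {1..d} \<times> {1..d}. i \<noteq> j}" using assms by simp
  then show ?thesis unfolding pair_distances_eq_image by blast
qed

lemma pair_distances_permute:
  fixes x :: "nat \<Rightarrow> real"
  assumes p: "bij_betw p {1..d} {1..d}"
  shows "{\<bar>x (p i) - x (p j)\<bar> | i j. i \<in> {1..d} \<and> j \<in> {1..d} \<and> i \<noteq> j}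
       = {\<bar>x i - x j\<bar> | i j. i \<in> {1..d} \<and> j \<in> {1..d} \<and> i \<noteq> j}"
proof -
  let ?P = "{(i, j) \<in> {1..d} \<times> {1..d}. i \<noteq> j}"
  have inj: "inj_on p {1..d}" using p by (rule bij_betw_imp_inj_on)
  have img: "p i \<in> {1..d}" if "i \<in> {1..d}" for i using p that by (rule bij_betw_apply)
  have "inj_on (map_prod p p) ?P" 
    by (rule inj_on_subset[OF map_prod_inj_on[OF inj inj]]) auto
  moreover have "map_prod p p ` ?P \<subseteq> ?P"
  proof
    fix z assume "z \<in> map_prod p p ` ?P"
    then obtain i j where ij: "z = (p i, p j)" "i \<in> {1..d}" "j \<in> {1..d}" "i \<noteq> j" by auto
    then have "p i \<noteq> p j" using inj_on_eq_iff[OF inj] by simp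
    then show "z \<in> ?P" using ij img by simp
  qed
  moreover have "finite ?P" by (rule finite_subset[of _ "{1..d} \<times> {1..d}"]) auto
  ultimately have "map_prod p p ` ?P = ?P" by (intro endo_inj_surj)
  then have "(\<lambda>(i, j). \<bar>x (p i) - x (p j)\<bar>) ` ?P = (\<lambda>(i, j). \<bar>x i - x j\<bar>) ` ?P"
    using image_image[of "\<lambda>(i, j). \<bar>x i - x j\<bar>" "map_prod p p" ?P] by (simp add: case_prod_unfold)
  then show ?thesis
    unfolding pair_distances_eq_image pair_distances_eq_image[of "\<lambda>i. x (p i)"] .
qed

lemma
  assumes p: "bij_betw p {1..d} {1..d}"
  shows f_min_permute: "f_min d (\<lambda>i. x (p i)) = f_min d x"
    and f_max_permute: "f_max d (\<lambda>i. x (p i)) = f_max d x"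
    and f_sum_permute: "f_sum d (\<lambda>i. x (p i)) = f_sum d x"
proof -
  show "f_min d (\<lambda>i. x (p i)) = f_min d x" "f_max d (\<lambda>i. x (p i)) = f_max d x"
    unfolding f_min_def f_max_def pair_distances_permute[OF p] by (rule refl)+
  have "f_sum d (\<lambda>i. x (p i)) = (\<Sum>i = 1..d. \<Sum>j = 1..d. \<bar>x (p i) - x j\<bar>)"
    unfolding f_sum_def by (intro sum.cong refl sum.reindex_bij_betw[OF p])
  also have "\<dots> = f_sum d x"
    unfolding f_sum_def by (rule sum.reindex_bij_betw[OF p])
  finally show "f_sum d (\<lambda>i. x (p i)) = f_sum d x" .
qed

text \<open>
  For increasing \<open>y\<close> this is the quantity \<open>W k\<close> of the introduction: largest \<open>d - k\<close> entries minus
  smallest \<open>k\<close> entries.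
\<close>
definition upper_minus_lower :: "nat \<Rightarrow> nat \<Rightarrow> (nat \<Rightarrow> real) \<Rightarrow> real" where
  "upper_minus_lower d k y = (\<Sum>i\<in>{k<..d}. y i) - (\<Sum>i = 1..k. y i)"

lemma upper_minus_lower_Suc:
  "k \<le> d \<Longrightarrow> upper_minus_lower (Suc d) k y = y (Suc d) + upper_minus_lower d k y"
proof -
  assume "k \<le> d"
  then have "{k<..Suc d} = insert (Suc d) {k<..d}" by auto
  then show ?thesis by (simp add: upper_minus_lower_def)
qed

text \<open>
  Shifting all entries by \<open>t\<close> changes the left-hand side by \<open>(d - 2 k) t\<close>, and then each signed entry is
  at most its absolute value. Equality holds if exactly the first \<open>k\<close> entries lie below \<open>t\<close>.
\<close>
lemma upper_minus_lower_le:
  assumes "k \<le> d"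
  shows "upper_minus_lower d k y \<le> (\<Sum>i = 1..d. \<bar>y i - t\<bar>) + (real d - 2 * real k) * t"
proof -
  have split: "{1..d} = {1..k} \<union> {k<..d}" using assms by auto
  have "(\<Sum>i\<in>{k<..d}. y i - t) \<le> (\<Sum>i\<in>{k<..d}. \<bar>y i - t\<bar>)" by (intro sum_mono) auto
  moreover have "(\<Sum>i = 1..k. t - y i) \<le> (\<Sum>i = 1..k. \<bar>y i - t\<bar>)" by (intro sum_mono) auto
  moreover have "(\<Sum>i = 1..d. \<bar>y i - t\<bar>) = (\<Sum>i = 1..k. \<bar>y i - t\<bar>) + (\<Sum>i\<in>{k<..d}. \<bar>y i - t\<bar>)"
    unfolding split by (intro sum.union_disjoint) auto
  ultimately show ?thesis
    using assms by (simp add: upper_minus_lower_def sum_subtractf of_nat_diff algebra_simps)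
qed

lemma f_sum_Suc:
  assumes "\<And>i. 1 \<le> i \<Longrightarrow> i \<le> d \<Longrightarrow> y i \<le> y (Suc d)"
  shows "f_sum (Suc d) y = f_sum d y + 2 * (real d * y (Suc d) - (\<Sum>i = 1..d. y i))"
proof -
  have "(\<Sum>i = 1..d. \<bar>y i - y (Suc d)\<bar>) = (\<Sum>i = 1..d. y (Suc d) - y i)"
    using assms by (intro sum.cong) auto
  moreover have "(\<Sum>i = 1..d. \<bar>y (Suc d) - y i\<bar>) = (\<Sum>i = 1..d. y (Suc d) - y i)"
    using assms by (intro sum.cong) auto
  ultimately show ?thesis by (simp add: f_sum_def sum.distrib sum_subtractf)
qed

text \<open>
  In the sum of all \<open>y j - y i\<close> with \<open>i < j\<close>, the entry \<open>y i\<close> has coefficient \<open>(i - 1) - (d - i)\<close>. This is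
  the number of cuts \<open>k < i\<close> minus the number of cuts \<open>k \<ge> i\<close>. The proof adds one largest point at a time.
\<close>
lemma f_sum_sorted:
  assumes "\<And>i j. 1 \<le> i \<Longrightarrow> i \<le> j \<Longrightarrow> j \<le> d \<Longrightarrow> y i \<le> y j"
  shows "f_sum d y = 2 * (\<Sum>k\<in>{1..<d}. upper_minus_lower d k y)"
  using assms
proof (induction d)
  case 0
  show ?case by (simp add: f_sum_def)
next
  case (Suc d)
  have IH: "f_sum d y = 2 * (\<Sum>k\<in>{1..<d}. upper_minus_lower d k y)"
    using Suc.prems by (intro Suc.IH) auto
  have step: "f_sum (Suc d) y = f_sum d y + 2 * (real d * y (Suc d) - (\<Sum>i = 1..d. y i))"
    using Suc.prems by (intro f_sum_Suc) auto
  have last: "upper_minus_lower d d y = - (\<Sum>i = 1..d. y i)" by (simp add: upper_minus_lower_def)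
  have "(\<Sum>k\<in>{1..<Suc d}. upper_minus_lower (Suc d) k y)
      = (\<Sum>k\<in>{1..<Suc d}. y (Suc d) + upper_minus_lower d k y)"
    by (intro sum.cong refl upper_minus_lower_Suc) auto
  also have "\<dots> = real d * y (Suc d) + (\<Sum>k\<in>{1..<Suc d}. upper_minus_lower d k y)"
    by (simp add: sum.distrib)
  also have "(\<Sum>k\<in>{1..<Suc d}. upper_minus_lower d k y)
      = (\<Sum>k\<in>{1..<d}. upper_minus_lower d k y) - (\<Sum>i = 1..d. y i)"
    by (cases "d = 0") (auto simp: last)
  finally show ?case unfolding step IH by simp
qed

lemma f_max_sorted:
  assumes d: "2 \<le> d" and mono: "\<And>i j. 1 \<le> i \<Longrightarrow> i \<le> j \<Longrightarrow> j \<le> d \<Longrightarrow> y i \<le> y j"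
  shows "f_max d y = y d - y 1"
  unfolding f_max_def
proof (rule Max_eqI[OF finite_pair_distances])
  fix z assume "z \<in> {\<bar>y i - y j\<bar> | i j. i \<in> {1..d} \<and> j \<in> {1..d} \<and> i \<noteq> j}"
  then obtain i j where ij: "z = \<bar>y i - y j\<bar>" "i \<in> {1..d}" "j \<in> {1..d}" by blast
  have "y 1 \<le> y i" "y i \<le> y d" "y 1 \<le> y j" "y j \<le> y d" using ij mono by auto
  then show "z \<le> y d - y 1" using ij by auto
next
  have "y d - y 1 = \<bar>y d - y 1\<bar>" using mono[of 1 d] d by simp
  then show "y d - y 1 \<in> {\<bar>y i - y j\<bar> | i j. i \<in> {1..d} \<and> j \<in> {1..d} \<and> i \<noteq> j}" using d by fastforce
qed

text \<open>
  The thresholds \<open>t k\<close> are free, one for each cut. The right-hand side is symmetric in the coordinates, so it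
  does not change when they are sorted.
\<close>
lemma f_sum_le:
  "f_sum d x \<le> (\<Sum>i = 1..d. \<Sum>k\<in>{1..<d}. 2 * \<bar>x i - t k\<bar>) + (\<Sum>k\<in>{1..<d}. 2 * ((real d - 2 * real k) * t k))"
proof -
  obtain p where p: "bij_betw p {1..d} {1..d}"
    and mono: "\<And>i j. 1 \<le> i \<Longrightarrow> i \<le> j \<Longrightarrow> j \<le> d \<Longrightarrow> x (p i) \<le> x (p j)"
    by (rule exists_increasing_rearrangement[of d x]) blast
  let ?y = "\<lambda>i. x (p i)"
  have "f_sum d x = 2 * (\<Sum>k\<in>{1..<d}. upper_minus_lower d k ?y)"
    unfolding f_sum_permute[OF p, of x, symmetric] by (rule f_sum_sorted[OF mono])
  also have "\<dots> \<le> 2 * (\<Sum>k\<in>{1..<d}. (\<Sum>i = 1..d. \<bar>?y i - t k\<bar>) + (real d - 2 * real k) * t k)"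
    by (intro mult_left_mono sum_mono upper_minus_lower_le) auto
  also have "\<dots> = 2 * (\<Sum>k\<in>{1..<d}. (\<Sum>i = 1..d. \<bar>x i - t k\<bar>) + (real d - 2 * real k) * t k)"
    by (simp only: sum.reindex_bij_betw[OF p, of "\<lambda>i. \<bar>x i - t _\<bar>"])
  also have "\<dots> = (\<Sum>i = 1..d. \<Sum>k\<in>{1..<d}. 2 * \<bar>x i - t k\<bar>) + (\<Sum>k\<in>{1..<d}. 2 * ((real d - 2 * real k) * t k))"
    by (subst sum.swap[of "\<lambda>i k. 2 * \<bar>x i - t k\<bar>"]) (simp add: sum.distrib sum_distrib_left)
  finally show ?thesis .
qed

text \<open>
  Twice the range is the sum of the cuts after the first and before the last point, because the inner
  points cancel; \<open>s\<close> and \<open>t\<close> are the thresholds for these two cuts.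
\<close>
lemma f_max_le:
  assumes d: "2 \<le> d"
  shows "f_max d x \<le> (\<Sum>i = 1..d. (\<bar>x i - s\<bar> + \<bar>x i - t\<bar>) / 2) + (real d - 2) * (s - t) / 2"
proof -
  obtain p where p: "bij_betw p {1..d} {1..d}"
    and mono: "\<And>i j. 1 \<le> i \<Longrightarrow> i \<le> j \<Longrightarrow> j \<le> d \<Longrightarrow> x (p i) \<le> x (p j)"
    by (rule exists_increasing_rearrangement[of d x]) blast
  let ?y = "\<lambda>i. x (p i)"
  have first: "{1..d} = insert 1 {1<..d}" and last: "{1..d} = insert d {1..d - 1}" "{d - 1<..d} = {d}"
    using d by auto
  have "(\<Sum>i = 1..d. ?y i) = ?y 1 + (\<Sum>i\<in>{1<..d}. ?y i)" unfolding first by simp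
  moreover have "(\<Sum>i = 1..d. ?y i) = ?y d + (\<Sum>i = 1..d - 1. ?y i)" unfolding last(1) using d by simp
  ultimately have "2 * (?y d - ?y 1) = upper_minus_lower d 1 ?y + upper_minus_lower d (d - 1) ?y"
    using last by (simp add: upper_minus_lower_def)
  also have "\<dots> \<le> (\<Sum>i = 1..d. \<bar>?y i - s\<bar>) + (real d - 2) * s
       + ((\<Sum>i = 1..d. \<bar>?y i - t\<bar>) - (real d - 2) * t)"
    using upper_minus_lower_le[of 1 d ?y s] upper_minus_lower_le[of "d - 1" d ?y t] d
    by (simp add: of_nat_diff algebra_simps)
  also have "\<dots> = (\<Sum>i = 1..d. \<bar>x i - s\<bar>) + (\<Sum>i = 1..d. \<bar>x i - t\<bar>) + (real d - 2) * (s - t)"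
    using sum.reindex_bij_betw[OF p, of "\<lambda>i. \<bar>x i - s\<bar>"] sum.reindex_bij_betw[OF p, of "\<lambda>i. \<bar>x i - t\<bar>"]
    by (simp add: algebra_simps)
  finally have "2 * (?y d - ?y 1) \<le> (\<Sum>i = 1..d. \<bar>x i - s\<bar>) + (\<Sum>i = 1..d. \<bar>x i - t\<bar>) + (real d - 2) * (s - t)" .
  moreover have "f_max d x = ?y d - ?y 1"
    unfolding f_max_permute[OF p, of x, symmetric] by (rule f_max_sorted[OF d mono])
  ultimately show ?thesis by (simp add: sum.distrib add_divide_distrib sum_divide_distrib[symmetric])
qed

lemma le_f_min:
  assumes d: "2 \<le> d" and le: "\<And>i j. 1 \<le> i \<Longrightarrow> i < j \<Longrightarrow> j \<le> d \<Longrightarrow> m \<le> \<bar>x i - x j\<bar>"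
  shows "m \<le> f_min d x"
  unfolding f_min_def
proof (rule Min.boundedI[OF finite_pair_distances pair_distances_nonempty[OF d]])
  fix z assume "z \<in> {\<bar>x i - x j\<bar> | i j. i \<in> {1..d} \<and> j \<in> {1..d} \<and> i \<noteq> j}"
  then obtain i j where "z = \<bar>x i - x j\<bar>" "i \<in> {1..d}" "j \<in> {1..d}" "i \<noteq> j" by blast
  then show "m \<le> z" using le[of i j] le[of j i] by (cases "i < j") (auto simp: abs_minus_commute)
qed

lemma f_min_le:
  assumes "1 \<le> i" "i < j" "j \<le> d"
  shows "f_min d x \<le> \<bar>x i - x j\<bar>"
  unfolding f_min_def using assms by (intro Min_le finite_pair_distances) fastforce

text \<open>
  Between sorted points \<open>i\<close> and \<open>j\<close> there are \<open>j - i\<close> consecutive gaps, each at least the minimal distance.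
\<close>
lemma f_min_gap_sorted:
  assumes mono: "\<And>i j. 1 \<le> i \<Longrightarrow> i \<le> j \<Longrightarrow> j \<le> d \<Longrightarrow> y i \<le> y j"
    and i: "1 \<le> i" and ij: "i \<le> j" and j: "j \<le> d"
  shows "real (j - i) * f_min d y \<le> y j - y i"
  using ij j
proof (induction j rule: dec_induct)
  case (step j)
  have "f_min d y \<le> \<bar>y j - y (Suc j)\<bar>" using step i by (intro f_min_le) auto
  moreover have "y j \<le> y (Suc j)" using step i by (intro mono) auto
  moreover have "real (Suc j - i) * f_min d y = real (j - i) * f_min d y + f_min d y"
    using step by (simp add: Suc_diff_le algebra_simps)
  ultimately show ?case using step by auto
qed simp

lemma f_min_le_f_max:
  assumes d: "2 \<le> d"
  shows "(real d - 1) * f_min d x \<le> f_max d x"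
proof -
  obtain p where p: "bij_betw p {1..d} {1..d}"
    and mono: "\<And>i j. 1 \<le> i \<Longrightarrow> i \<le> j \<Longrightarrow> j \<le> d \<Longrightarrow> x (p i) \<le> x (p j)"
    by (rule exists_increasing_rearrangement[of d x]) blast
  have "real (d - 1) * f_min d (\<lambda>i. x (p i)) \<le> x (p d) - x (p 1)"
    using d by (intro f_min_gap_sorted mono) auto
  moreover have "f_max d (\<lambda>i. x (p i)) = x (p d) - x (p 1)" by (rule f_max_sorted[OF d mono])
  ultimately show ?thesis
    using d by (simp add: f_min_permute[OF p] f_max_permute[OF p] of_nat_diff)
qed

text \<open>
  The points \<open>1, \<dots>, d\<close> have minimal distance 1 and \<open>f_sum\<close> equal to \<open>d (d\<^sup>2 - 1) / 3\<close>, and among the points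
  with a given minimal distance the equally spaced ones minimise \<open>f_sum\<close>.
\<close>
lemma f_min_le_f_sum:
  "real d * ((real d)\<^sup>2 - 1) / 3 * f_min d x \<le> f_sum d x"
proof -
  obtain p where p: "bij_betw p {1..d} {1..d}"
    and mono: "\<And>i j. 1 \<le> i \<Longrightarrow> i \<le> j \<Longrightarrow> j \<le> d \<Longrightarrow> x (p i) \<le> x (p j)"
    by (rule exists_increasing_rearrangement[of d x]) blast
  let ?y = "\<lambda>i. x (p i)" and ?g = "f_min d x"
  have gap: "real (j - i) * ?g \<le> ?y j - ?y i" if "1 \<le> i" "i \<le> j" "j \<le> d" for i j
    using f_min_gap_sorted[where y = ?y, OF mono that] by (simp add: f_min_permute[OF p])
  have "real m * ((real m)\<^sup>2 - 1) / 3 * ?g \<le> f_sum m ?y" if "m \<le> d" for m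
    using that
  proof (induction m)
    case (Suc m)
    have "(\<Sum>i = 1..m. real (Suc m - i)) = (\<Sum>i = 1..m. real i)"
      by (rule sum.reindex_bij_witness[of _ "\<lambda>i. Suc m - i" "\<lambda>i. Suc m - i"]) auto
    also have "\<dots> = real m * (real m + 1) / 2"
      by (induction m) (simp_all add: field_simps)
    finally have gaps: "(\<Sum>i = 1..m. real (Suc m - i)) = real m * (real m + 1) / 2" .
    have "(\<Sum>i = 1..m. real (Suc m - i) * ?g) \<le> (\<Sum>i = 1..m. ?y (Suc m) - ?y i)"
      using Suc.prems by (intro sum_mono gap) auto
    then have "real m * (real m + 1) / 2 * ?g \<le> real m * ?y (Suc m) - (\<Sum>i = 1..m. ?y i)"
      by (simp only: sum_distrib_right[symmetric] gaps) (simp add: sum_subtractf)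
    moreover have "f_sum (Suc m) ?y = f_sum m ?y + 2 * (real m * ?y (Suc m) - (\<Sum>i = 1..m. ?y i))"
      using Suc.prems by (intro f_sum_Suc mono) auto
    moreover have "real (Suc m) * ((real (Suc m))\<^sup>2 - 1) / 3 * ?g
        = real m * ((real m)\<^sup>2 - 1) / 3 * ?g + 2 * (real m * (real m + 1) / 2 * ?g)"
      by (simp add: field_simps power2_eq_square)
    ultimately show ?case using Suc by simp
  qed (simp add: f_sum_def)
  from this[of d] show ?thesis by (simp add: f_sum_permute[OF p])
qed

section \<open>Windows of the drifting sequence\<close>

text \<open>
  The difference of the fractional parts differs from \<open>a - b\<close> by an integer, so it cannot be closer to 0 than
  \<open>a - b\<close> is to the integers. Only 0 and 1 need to be compared: if \<open>a - b > 1\<close>, the bound is negative.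
\<close>
lemma frac_diff_ge:
  fixes a b :: real
  assumes "b \<le> a"
  shows "min (a - b) (1 - (a - b)) \<le> \<bar>frac b - frac a\<bar>"
proof -
  define z where "z = \<lfloor>a\<rfloor> - \<lfloor>b\<rfloor>"
  have eq: "frac b - frac a = of_int z - (a - b)" by (simp add: z_def frac_def)
  consider "z \<le> 0" | "1 \<le> z" by linarith
  then show ?thesis
  proof cases
    case 1
    then have "real_of_int z \<le> 0" by simp
    then show ?thesis unfolding eq using assms by linarith
  next
    case 2
    then have "1 \<le> real_of_int z" by simp
    then show ?thesis unfolding eq by linarith
  qed
qed

text \<open>
  Two members of the window at \<open>n\<close> differ, before taking fractional parts, by \<open>((j - i) + \<eta>) / d\<close> with
  \<open>1 \<le> j - i \<le> d - 1\<close>, where \<open>\<eta>\<close> is the difference of the roots. As \<open>\<eta> \<le> d / sqrt n\<close>, their distance on the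
  circle is at least \<open>(1 - \<eta>) / d\<close>.
\<close>
lemma f_min_drifting_window:
  assumes d: "2 \<le> d" and n: "1 \<le> n"
  shows "1 / real d - 1 / sqrt (real n)
           \<le> f_min d (window d (\<lambda>n. frac ((real n + sqrt (real n)) / real d)) n)"
proof (rule le_f_min[OF d])
  let ?u = "\<lambda>n. (real n + sqrt (real n)) / real d"
  fix i j :: nat assume ij: "1 \<le> i" "i < j" "j \<le> d"
  define a b where "a = n + j - 1" and "b = n + i - 1"
  define \<eta> where "\<eta> = sqrt (real a) - sqrt (real b)"
  have ab: "n \<le> b" "b < a" "real a - real b = real (j - i)" "1 \<le> j - i" "j - i \<le> d - 1"
    using ij n by (auto simp: a_def b_def)
  have \<eta>0: "0 \<le> \<eta>" using ab by (simp add: \<eta>_def)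
  have \<eta>_le: "\<eta> \<le> real d / sqrt (real n)"
  proof -
    have "sqrt (real n) * \<eta> \<le> (sqrt (real a) + sqrt (real b)) * \<eta>"
      using ab \<eta>0 by (intro mult_right_mono) (auto simp: add_increasing2)
    also have "\<dots> = real a - real b"
      by (simp add: \<eta>_def algebra_simps)
    also have "\<dots> \<le> real d" using ab d by (simp add: of_nat_diff)
    finally show ?thesis using n by (simp add: field_simps)
  qed
  have diff: "?u a - ?u b = (real (j - i) + \<eta>) / real d"
    by (simp add: ab(3)[symmetric] \<eta>_def diff_divide_distrib[symmetric])
  have "1 / real d - 1 / sqrt (real n) \<le> (1 - \<eta>) / real d"
    using \<eta>_le d by (simp add: diff_divide_distrib divide_le_eq mult.commute)
  also have "\<dots> \<le> min (?u a - ?u b) (1 - (?u a - ?u b))"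
  proof (rule min.boundedI)
    show "(1 - \<eta>) / real d \<le> ?u a - ?u b"
      unfolding diff using \<eta>0 ab by (intro divide_right_mono) auto
    have "real (j - i) \<le> real d - 1" using ab d by (simp add: of_nat_diff)
    then have "(1 - \<eta>) / real d \<le> (real d - (real (j - i) + \<eta>)) / real d"
      by (intro divide_right_mono) auto
    also have "\<dots> = 1 - (real (j - i) + \<eta>) / real d" using d by (simp add: diff_divide_distrib)
    finally show "(1 - \<eta>) / real d \<le> 1 - (?u a - ?u b)" unfolding diff .
  qed
  also have "\<dots> \<le> \<bar>frac (?u b) - frac (?u a)\<bar>"
    using ab by (intro frac_diff_ge divide_right_mono add_mono real_sqrt_le_mono) auto
  finally show "1 / real d - 1 / sqrt (real n)
      \<le> \<bar>window d (\<lambda>n. frac (?u n)) n i - window d (\<lambda>n. frac (?u n)) n j\<bar>"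
    using ij by (simp add: window_def a_def b_def)
qed

lemma sum_inverse_sqrt_le: "(\<Sum>n = 1..N. 1 / sqrt (real n)) \<le> 2 * sqrt (real N)"
proof (induction N)
  case (Suc N)
  let ?x = "sqrt (real (Suc N))" and ?y = "sqrt (real N)"
  have "1 = (?x - ?y) * (?x + ?y)" by (simp add: algebra_simps)
  also have "\<dots> \<le> (?x - ?y) * (2 * ?x)" by (intro mult_left_mono) auto
  finally have "1 / ?x \<le> 2 * (?x - ?y)" by (simp add: field_simps)
  then show ?case using Suc by simp
qed simp

text \<open>
  The drifting sequence is the witness. Its loss \<open>1 / sqrt n\<close> per window is only of order \<open>sqrt N\<close> in total
  and vanishes in the mean.
\<close>
lemma B_ge:
  assumes d: "2 \<le> d" and \<kappa>: "0 \<le> \<kappa>" and le: "\<And>w. \<kappa> * f_min d w \<le> f w"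
  shows "ereal (\<kappa> / real d) \<le> B d f"
proof -
  define x where "x = (\<lambda>n. frac ((real n + sqrt (real n)) / real d))"
  have x: "x \<in> ud_sequences"
    unfolding x_def using d by (intro drifting_residues_uniformly_distributed) auto
  have "(\<lambda>N. \<kappa> / real d - \<kappa> * (2 * sqrt (real N) / real N)) \<longlonglongrightarrow> \<kappa> / real d - \<kappa> * 0"
    by (intro tendsto_intros) real_asymp
  then have lim: "limsup (\<lambda>N. ereal (\<kappa> / real d - \<kappa> * (2 * sqrt (real N) / real N))) = ereal (\<kappa> / real d)"
    by (intro lim_imp_Limsup) simp_all
  have "eventually (\<lambda>N. ereal (\<kappa> / real d - \<kappa> * (2 * sqrt (real N) / real N))
      \<le> ereal (1 / real N * (\<Sum>n = 1..N. f (window d x n)))) sequentially"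
    using eventually_gt_at_top[of 0]
  proof eventually_elim
    case (elim N)
    have "\<kappa> * (1 / real d - 1 / sqrt (real n)) \<le> f (window d x n)" if "1 \<le> n" for n
      using mult_left_mono[OF f_min_drifting_window[OF d that] \<kappa>] le[of "window d x n"]
      unfolding x_def by linarith
    then have "1 / real N * (\<Sum>n = 1..N. \<kappa> * (1 / real d - 1 / sqrt (real n)))
        \<le> 1 / real N * (\<Sum>n = 1..N. f (window d x n))"
      by (intro mult_left_mono sum_mono) auto
    moreover have "1 / real N * (\<Sum>n = 1..N. \<kappa> * (1 / real d - 1 / sqrt (real n)))
        = \<kappa> / real d - \<kappa> * ((\<Sum>n = 1..N. 1 / sqrt (real n)) / real N)"
      using elim unfolding sum_distrib_left[symmetric]
      by (simp add: sum_subtractf diff_divide_distrib right_diff_distrib)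
    moreover have "\<kappa> * ((\<Sum>n = 1..N. 1 / sqrt (real n)) / real N) \<le> \<kappa> * (2 * sqrt (real N) / real N)"
      using \<kappa> by (intro mult_left_mono divide_right_mono sum_inverse_sqrt_le) auto
    ultimately show ?case by simp
  qed
  then have "ereal (\<kappa> / real d) \<le> limsup (\<lambda>N. ereal (1 / real N * (\<Sum>n = 1..N. f (window d x n))))"
    unfolding lim[symmetric] by (rule Limsup_mono)
  then show ?thesis unfolding B_def using x by (rule SUP_upper2[rotated])
qed

section \<open>The extremal values\<close>

text \<open>
  The cuts of \<open>f_max\<close> are thresholded at \<open>1 / d\<close> and \<open>1 - 1 / d\<close>. The factor \<open>c\<close> lets the same estimate
  serve \<open>f_max\<close>, with \<open>c = 1\<close>, and \<open>f_min\<close>, with \<open>c = d - 1\<close>.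
\<close>
lemma B_le_of_f_max:
  assumes d: "2 \<le> d" and f: "\<And>w. c * f w \<le> f_max d w" and c: "0 < c"
  shows "B d f \<le> ereal ((real d - 1) / (real d * c))"
proof -
  let ?s = "1 / real d" and ?t = "1 - 1 / real d"
  let ?h = "\<lambda>u. (\<bar>u - ?s\<bar> + \<bar>u - ?t\<bar>) / (2 * c)"
  have "f w \<le> (\<Sum>k = 1..d. ?h (w k)) + (real d - 2) * (?s - ?t) / (2 * c)" for w
  proof -
    have "f w = (c * f w) / c" using c by simp
    also have "\<dots> \<le> ((\<Sum>k = 1..d. (\<bar>w k - ?s\<bar> + \<bar>w k - ?t\<bar>) / 2) + (real d - 2) * (?s - ?t) / 2) / c"
      using c f[of w] f_max_le[OF d, of w ?s ?t] by (intro divide_right_mono) auto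
    finally show ?thesis by (simp add: add_divide_distrib sum_divide_distrib)
  qed
  then have "B d f \<le> ereal (real d * integral {0..1} ?h + (real d - 2) * (?s - ?t) / (2 * c))"
    using c by (intro B_le continuous_intros) auto
  moreover have "integral {0..1} ?h = ((?s\<^sup>2 + (1 - ?s)\<^sup>2) / 2 + (?t\<^sup>2 + (1 - ?t)\<^sup>2) / 2) / (2 * c)"
    using d by (intro integral_unique has_integral_divide has_integral_add integral_abs_diff) auto
  moreover have "real d * (((?s\<^sup>2 + (1 - ?s)\<^sup>2) / 2 + (?t\<^sup>2 + (1 - ?t)\<^sup>2) / 2) / (2 * c))
      + (real d - 2) * (?s - ?t) / (2 * c) = (real d - 1) / (real d * c)"
    using c d by (simp add: field_simps power2_eq_square)
  ultimately show ?thesis by (simp only:)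
qed

lemma sum_squares_lessThan:
  "(\<Sum>k\<in>{1..<d}. (real k)\<^sup>2) = real d * (real d - 1) * (2 * real d - 1) / 6"
proof (induction d)
  case (Suc d)
  then show ?case by (cases "d = 0") (auto simp: field_simps power2_eq_square)
qed simp

lemma B_f_sum_le:
  assumes d: "1 \<le> d"
  shows "B d (f_sum d) \<le> ereal (((real d)\<^sup>2 - 1) / 3)"
proof -
  let ?t = "\<lambda>k. real k / real d"
  let ?h = "\<lambda>u. \<Sum>k\<in>{1..<d}. 2 * \<bar>u - ?t k\<bar>"
  let ?c = "\<Sum>k\<in>{1..<d}. 2 * ((real d - 2 * real k) * ?t k)"
  have le: "B d (f_sum d) \<le> ereal (real d * integral {0..1} ?h + ?c)"
    by (intro B_le f_sum_le continuous_intros)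
  have int: "integral {0..1} ?h = (\<Sum>k\<in>{1..<d}. 2 * (((?t k)\<^sup>2 + (1 - ?t k)\<^sup>2) / 2))"
    using d by (intro integral_unique has_integral_sum has_integral_mult_right integral_abs_diff) auto
  have "real d * integral {0..1} ?h + ?c
      = (\<Sum>k\<in>{1..<d}. real d * (2 * (((?t k)\<^sup>2 + (1 - ?t k)\<^sup>2) / 2)) + 2 * ((real d - 2 * real k) * ?t k))"
    unfolding int by (simp only: sum_distrib_left sum.distrib)
  also have "\<dots> = (\<Sum>k\<in>{1..<d}. real d - 2 / real d * (real k)\<^sup>2)"
    using d by (intro sum.cong refl) (simp add: field_simps power2_eq_square)
  also have "\<dots> = (real d - 1) * real d - 2 / real d * (\<Sum>k\<in>{1..<d}. (real k)\<^sup>2)"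
    using d by (simp add: sum_subtractf sum_distrib_left of_nat_diff)
  also have "\<dots> = ((real d)\<^sup>2 - 1) / 3"
    unfolding sum_squares_lessThan using d by (simp add: field_simps power2_eq_square)
  finally show ?thesis using le by (simp only:)
qed

theorem theorem5p3:
  fixes d :: nat
  assumes "d \<ge> 2"
  shows "B d (f_min d) = ereal (1 / real d) \<and>
         B d (f_max d) = ereal ((real d - 1) / real d) \<and>
         B d (f_sum d) = ereal (((real d)\<^sup>2 - 1) / 3)"
proof (intro conjI antisym)
  show "B d (f_min d) \<le> ereal (1 / real d)"
    using B_le_of_f_max[OF assms f_min_le_f_max[OF assms]] assms by simp
  show "ereal (1 / real d) \<le> B d (f_min d)"
    by (rule B_ge[OF assms]) auto
  show "B d (f_max d) \<le> ereal ((real d - 1) / real d)"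
    using B_le_of_f_max[OF assms, of 1 "f_max d"] by simp
  show "ereal ((real d - 1) / real d) \<le> B d (f_max d)"
    using assms by (intro B_ge f_min_le_f_max) auto
  show "B d (f_sum d) \<le> ereal (((real d)\<^sup>2 - 1) / 3)"
    using assms by (intro B_f_sum_le) auto
  have "ereal (real d * ((real d)\<^sup>2 - 1) / 3 / real d) \<le> B d (f_sum d)"
    using assms by (intro B_ge f_min_le_f_sum) (auto simp: one_le_power)
  then show "ereal (((real d)\<^sup>2 - 1) / 3) \<le> B d (f_sum d)"
    using assms by simp
qed

end
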